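(* Let $\Phi = \bigwedge_{w\in\{\top,\bot\}^n} \phi_w$ be an unsatisfiable CNF formula of $\mathcal{T}_U$, with partitions $\phi_w$ and global symbol set $G = \bigcap_w Symb(\phi_w)$, and let $P$ be a colorable, local-first unsatisfiability proof of $\Phi$. Annotate the nodes of $P$ with vectors of $n$ formulas according to the following rules: (mHyp) a leaf whose clause $C$ belongs to $\phi_w$ is annotated with the constant vector $w$; (mAxi) a leaf whose clause $C$ is a theory-tautology clause with $C \preceq \phi_w$ is annotated with $w$; (mRes) a resolution node with pivot $a$, premises $a\vee C$ and $\neg a \vee D$ both annotated with the same $w\in\{\top,\bot\}^n$, and $a\vee C\vee D \preceq \phi_w$, is annotated with $w$; (mResG) a resolution node with pivot $a$ satisfying $a\preceq G$, premises $a\vee C$ annotated with $\bar I^C=(I^C_1,\dots,I^C_n)$ and $\neg a\vee D$ annotated with $\bar I^D$, is annotated with $\big((a\vee I^C_1)\wedge(\neg a \vee I^D_1),\dots,(a\vee I^C_n)\wedge(\neg a\vee I^D_n)\big)$. Then every annotation so produced is an $n$-partial interpolant, with respect to the $\phi_w$, for the clause of the node it annotates; in particular the annotation of the root (the empty clause) is an $n$-interpolant.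
   Context: $\mathcal{T}_U$ is the theory of uninterpreted functions and equality (terms built from variables and uninterpreted function symbols; atoms are Boolean variables, uninterpreted predicate instances and equalities; formulas built with $\neg,\vee$). A literal is an atom or its negation; a clause is a set of literals read as a disjunction (the empty clause is $\bot$); a CNF formula is a set of clauses read as a conjunction. $Symb(\varphi)$ is the set of variables, function and predicate symbols in $\varphi$; $\varphi\preceq\psi$ means $Symb(\varphi)\subseteq Symb(\psi)$, and $\varphi \preceq G$ means $Symb(\varphi)\subseteq G$. For a clause $C$, $C|_w$ is the clause of literals $s\in C$ with $s\preceq \phi_w$. A theory-tautology clause is a clause valid in $\mathcal{T}_U$. An unsatisfiability proof of $\Phi$ is a DAG whose leaves are labeled with clauses of $\Phi$ (rule Hyp) or theory-tautology clauses (rule Axi), whose internal nodes are labeled with the resolvent $C\vee D$ of their two premises $a\vee C$ and $\neg a\vee D$ (the literal $a$ being the pivot), and whose root is labeled with the empty clause. The proof is colorable if every leaf clause $C$ satisfies $C\preceq\phi_w$ for some $w$; it is local-first if for every resolution node whose pivot is not $\preceq G$ (a local pivot), both premises are derived from the same partition $\phi_w$. For $w\in\{\top,\bot\}^n$ with entries $w_j$ and a vector $\bar I=(I_1,\dots,I_n)$, $\bar I\oplus w$ is the vector $(I_1\oplus w_1,\dots,I_n\oplus w_n)$ ($\oplus$ is exclusive-or; $I\oplus \bot = I$, $I\oplus\top = \neg I$), and $\bigvee \bar I$ denotes $I_1\vee\dots\vee I_n$. Given a clause $C$ with $\Phi \Rightarrow C$, an $n$-partial interpolant for $C$ with respect to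 the $\phi_w$ is a vector $\bar I$ of $n$ formulas with $Symb(I_j)\subseteq G$ for all $j$ and such that for every $w\in\{\top,\bot\}^n$, $\phi_w \Rightarrow \big(C|_w \vee \bigvee(\bar I \oplus w)\big)$ is valid in $\mathcal{T}_U$; if $C$ is the empty clause it is called an $n$-interpolant. *)

theory Defs
  imports Main
begin

section \<open>Syntax\<close>

text \<open>
  A function or predicate symbol is a name together with an arity, the arity of an occurrence being
  the number of its arguments. Hence every term is well-formed, and \<open>f\<close> applied to one argument
  and \<open>f\<close> applied to two arguments are instances of different symbols.
\<close>

datatype 'a symbol = DomVar 'a | BoolVar 'a | FunSym 'a nat | PredSym 'a nat

datatype 'a trm = Var 'a | App 'a "'a trm list"

datatype 'a atom = BVar 'a | Pred 'a "'a trm list" | Eq "'a trm" "'a trm"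

text \<open>
  The truth constants are formulas of their own: they are needed as entries of interpolants even if
  there is no global symbol.
\<close>

datatype 'a form = Const bool | Atom "'a atom" | Neg "'a form" | Or "'a form" "'a form"

definition And :: "'a form \<Rightarrow> 'a form \<Rightarrow> 'a form" where
  "And \<phi> \<psi> = Neg (Or (Neg \<phi>) (Neg \<psi>))"

definition Disj :: "'a form list \<Rightarrow> 'a form" where
  "Disj Is = foldr Or Is (Const False)"

datatype 'a literal = LPos "'a atom" | LNeg "'a atom"

fun compl :: "'a literal \<Rightarrow> 'a literal" where
  "compl (LPos a) = LNeg a"
| "compl (LNeg a) = LPos a"

fun lit_form :: "'a literal \<Rightarrow> 'a form" where
  "lit_form (LPos a) = Atom a"
| "lit_form (LNeg a) = Neg (Atom a)"

type_synonym 'a clause = "'a literal set"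
type_synonym 'a cnf = "'a clause set"

definition is_clause :: "'a clause \<Rightarrow> bool" where
  "is_clause C \<longleftrightarrow> finite C"

definition is_cnf :: "'a cnf \<Rightarrow> bool" where
  "is_cnf \<Phi> \<longleftrightarrow> finite \<Phi> \<and> (\<forall>C\<in>\<Phi>. is_clause C)"

fun symb_trm :: "'a trm \<Rightarrow> 'a symbol set" where
  "symb_trm (Var x) = {DomVar x}"
| "symb_trm (App f ts) = insert (FunSym f (length ts)) (\<Union>t\<in>set ts. symb_trm t)"

fun symb_atom :: "'a atom \<Rightarrow> 'a symbol set" where
  "symb_atom (BVar b) = {BoolVar b}"
| "symb_atom (Pred p ts) = insert (PredSym p (length ts)) (\<Union>t\<in>set ts. symb_trm t)"
| "symb_atom (Eq s t) = symb_trm s \<union> symb_trm t"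

fun symb :: "'a form \<Rightarrow> 'a symbol set" where
  "symb (Const b) = {}"
| "symb (Atom a) = symb_atom a"
| "symb (Neg \<phi>) = symb \<phi>"
| "symb (Or \<phi> \<psi>) = symb \<phi> \<union> symb \<psi>"

definition symb_lit :: "'a literal \<Rightarrow> 'a symbol set" where
  "symb_lit l = symb (lit_form l)"

definition symb_clause :: "'a clause \<Rightarrow> 'a symbol set" where
  "symb_clause C = (\<Union>l\<in>C. symb_lit l)"

definition symb_cnf :: "'a cnf \<Rightarrow> 'a symbol set" where
  "symb_cnf \<Phi> = (\<Union>C\<in>\<Phi>. symb_clause C)"


section \<open>Semantics\<close>

record ('a, 'd) struc =
  univ :: "'d set"
  ivar :: "'a \<Rightarrow> 'd"
  ibool :: "'a \<Rightarrow> bool"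
  ifun :: "'a \<Rightarrow> 'd list \<Rightarrow> 'd"
  ipred :: "'a \<Rightarrow> 'd list \<Rightarrow> bool"

definition is_struc :: "('a, 'd) struc \<Rightarrow> bool" where
  "is_struc M \<longleftrightarrow> univ M \<noteq> {} \<and> (\<forall>x. ivar M x \<in> univ M) \<and>
     (\<forall>f. \<forall>ds\<in>lists (univ M). ifun M f ds \<in> univ M)"

fun val :: "('a, 'd) struc \<Rightarrow> 'a trm \<Rightarrow> 'd" where
  "val M (Var x) = ivar M x"
| "val M (App f ts) = ifun M f (map (val M) ts)"

fun sat_atom :: "('a, 'd) struc \<Rightarrow> 'a atom \<Rightarrow> bool" where
  "sat_atom M (BVar b) \<longleftrightarrow> ibool M b"
| "sat_atom M (Pred p ts) \<longleftrightarrow> ipred M p (map (val M) ts)"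
| "sat_atom M (Eq s t) \<longleftrightarrow> val M s = val M t"

fun sat :: "('a, 'd) struc \<Rightarrow> 'a form \<Rightarrow> bool" where
  "sat M (Const b) \<longleftrightarrow> b"
| "sat M (Atom a) \<longleftrightarrow> sat_atom M a"
| "sat M (Neg \<phi>) \<longleftrightarrow> \<not> sat M \<phi>"
| "sat M (Or \<phi> \<psi>) \<longleftrightarrow> sat M \<phi> \<or> sat M \<psi>"

definition sat_clause :: "('a, 'd) struc \<Rightarrow> 'a clause \<Rightarrow> bool" where
  "sat_clause M C \<longleftrightarrow> (\<exists>l\<in>C. sat M (lit_form l))"

definition sat_cnf :: "('a, 'd) struc \<Rightarrow> 'a cnf \<Rightarrow> bool" where
  "sat_cnf M \<Phi> \<longleftrightarrow> (\<forall>C\<in>\<Phi>. sat_clause M C)"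

text \<open>
  HOL cannot quantify over all universes inside a definition. In the notions of validity below
  the universe ranges over the nonempty sets of natural numbers; by the following lemma this is the
  same as admitting nonempty universes of any type, because validity and unsatisfiability are
  always about finitely many formulas.
\<close>

fun subterms :: "'a trm \<Rightarrow> 'a trm set" where
  "subterms (Var x) = {Var x}"
| "subterms (App f ts) = insert (App f ts) (\<Union>t\<in>set ts. subterms t)"

fun terms_atom :: "'a atom \<Rightarrow> 'a trm set" where
  "terms_atom (BVar b) = {}"
| "terms_atom (Pred p ts) = (\<Union>t\<in>set ts. subterms t)"
| "terms_atom (Eq s t) = subterms s \<union> subterms t"

fun terms_form :: "'a form \<Rightarrow> 'a trm set" where
  "terms_form (Const b) = {}"
| "terms_form (Atom a) = terms_atom a"
| "terms_form (Neg \<phi>) = terms_form \<phi>"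
| "terms_form (Or \<phi> \<psi>) = terms_form \<phi> \<union> terms_form \<psi>"

lemma finite_subterms: "finite (subterms t)"
  by (induction t) auto

lemma finite_terms_form: "finite (terms_form \<phi>)"
proof (induction \<phi>)
  case (Atom a)
  then show ?case by (cases a) (auto simp: finite_subterms)
qed auto

lemma subterms_refl: "t \<in> subterms t"
  by (cases t) auto

lemma nat_universe_suffices:
  fixes M :: "('a, 'd) struc"
  assumes M: "is_struc M" and F: "finite F"
  shows "\<exists>M' :: ('a, nat) struc. is_struc M' \<and> (\<forall>\<phi>\<in>F. sat M' \<phi> \<longleftrightarrow> sat M \<phi>)"
proof -
  obtain d0 where "d0 \<in> univ M" using M by (auto simp: is_struc_def)
  define T where "T = (\<Union>\<phi>\<in>F. terms_form \<phi>)"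
  define S where "S = insert d0 (val M ` T)"
  have "finite S" using F by (simp add: S_def T_def finite_terms_form)
  then obtain h :: "'d \<Rightarrow> nat" where h: "inj_on h S"
    using finite_imp_inj_to_nat_seg by blast
  define g where "g = inv_into S h"
  define k where "k d = (if d \<in> S then h d else h d0)" for d
  define M' :: "('a, nat) struc" where
    "M' = \<lparr>univ = h ` S, ivar = (\<lambda>x. k (ivar M x)), ibool = ibool M,
       ifun = (\<lambda>f ds. k (ifun M f (map g ds))), ipred = (\<lambda>p ds. ipred M p (map g ds))\<rparr>"
  have M'_simps: "ivar M' x = k (ivar M x)" "ibool M' = ibool M"
    "ifun M' f ds = k (ifun M f (map g ds))" "ipred M' p ds = ipred M p (map g ds)" for x f p ds
    by (simp_all add: M'_def)
  have gk: "g (k d) = d" if "d \<in> S" for d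
    using that h by (simp add: g_def k_def)
  have "k d \<in> h ` S" for d by (auto simp: k_def S_def)
  then have "is_struc M'" by (auto simp: is_struc_def M'_def S_def)
  have inS: "val M t \<in> S" if "subterms t \<subseteq> T" for t
    using that subterms_refl[of t] by (auto simp: S_def)
  have v: "val M' t = k (val M t)" if "subterms t \<subseteq> T" for t
    using that
  proof (induction t)
    case (Var x)
    then show ?case by (simp only: val.simps sat.simps sat_atom.simps M'_simps)
  next
    case (App f ts)
    have "g (val M' t) = val M t" if "t \<in> set ts" for t
    proof -
      have "subterms t \<subseteq> T" using App.prems that by auto
      then show ?thesis using App.IH[OF that] gk[OF inS] by metis
    qed
    then have "map g (map (val M') ts) = map (val M) ts" by simp
    then show ?case by (simp only: val.simps sat.simps sat_atom.simps M'_simps)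
  qed
  have gv: "g (val M' t) = val M t" if "subterms t \<subseteq> T" for t
    using v[OF that] gk[OF inS[OF that]] by metis
  have "sat M' \<phi> \<longleftrightarrow> sat M \<phi>" if "terms_form \<phi> \<subseteq> T" for \<phi>
    using that
  proof (induction \<phi>)
    case (Atom a)
    show ?case
    proof (cases a)
      case (BVar b)
      then show ?thesis by (simp only: val.simps sat.simps sat_atom.simps M'_simps)
    next
      case (Pred p ts)
      then have "map g (map (val M') ts) = map (val M) ts"
        using Atom gv by (simp add: SUP_le_iff)
      then show ?thesis using Pred by (simp only: val.simps sat.simps sat_atom.simps M'_simps)
    next
      case (Eq s t)
      then have "subterms s \<subseteq> T" "subterms t \<subseteq> T" using Atom by auto
      then have "val M' s = val M' t \<longleftrightarrow> val M s = val M t" using gv v by metis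
      then show ?thesis using Eq by (simp only: sat.simps sat_atom.simps)
    qed
  qed auto
  then have "\<forall>\<phi>\<in>F. sat M' \<phi> \<longleftrightarrow> sat M \<phi>" unfolding T_def by blast
  with \<open>is_struc M'\<close> show ?thesis by blast
qed

definition unsatisfiable :: "'a cnf \<Rightarrow> bool" where
  "unsatisfiable \<Phi> \<longleftrightarrow> \<not> (\<exists>M :: ('a, nat) struc. is_struc M \<and> sat_cnf M \<Phi>)"

definition theory_tautology :: "'a clause \<Rightarrow> bool" where
  "theory_tautology C \<longleftrightarrow> (\<forall>M :: ('a, nat) struc. is_struc M \<longrightarrow> sat_clause M C)"

text \<open>\<open>valid_imp \<Phi> C \<psi>\<close> is validity of \<open>\<Phi> \<Rightarrow> C \<or> \<psi>\<close>.\<close>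

definition valid_imp :: "'a cnf \<Rightarrow> 'a clause \<Rightarrow> 'a form \<Rightarrow> bool" where
  "valid_imp \<Phi> C \<psi> \<longleftrightarrow> (\<forall>M :: ('a, nat) struc. is_struc M \<longrightarrow> sat_cnf M \<Phi> \<longrightarrow>
     sat_clause M C \<or> sat M \<psi>)"


section \<open>Partitioned formulas and partial interpolants\<close>

definition words :: "nat \<Rightarrow> bool list set" where
  "words n = {w. length w = n}"

definition conj_parts :: "nat \<Rightarrow> (bool list \<Rightarrow> 'a cnf) \<Rightarrow> 'a cnf" where
  "conj_parts n \<phi> = (\<Union>w\<in>words n. \<phi> w)"

definition global_symbols :: "nat \<Rightarrow> (bool list \<Rightarrow> 'a cnf) \<Rightarrow> 'a symbol set" where
  "global_symbols n \<phi> = (\<Inter>w\<in>words n. symb_cnf (\<phi> w))"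

definition restrict_clause :: "'a clause \<Rightarrow> 'a cnf \<Rightarrow> 'a clause" where
  "restrict_clause C \<Phi> = {s \<in> C. symb_lit s \<subseteq> symb_cnf \<Phi>}"

definition const_vec :: "bool list \<Rightarrow> 'a form list" where
  "const_vec w = map Const w"

definition xor_const :: "'a form \<Rightarrow> bool \<Rightarrow> 'a form" where
  "xor_const I b = (if b then Neg I else I)"

definition xor_vec :: "'a form list \<Rightarrow> bool list \<Rightarrow> 'a form list" where
  "xor_vec Is w = map2 xor_const Is w"

definition partial_interpolant ::
  "nat \<Rightarrow> (bool list \<Rightarrow> 'a cnf) \<Rightarrow> 'a clause \<Rightarrow> 'a form list \<Rightarrow> bool" where
  "partial_interpolant n \<phi> C Is \<longleftrightarrow>
     valid_imp (conj_parts n \<phi>) C (Const False) \<and>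
     length Is = n \<and>
     (\<forall>I\<in>set Is. symb I \<subseteq> global_symbols n \<phi>) \<and>
     (\<forall>w\<in>words n. valid_imp (\<phi> w) (restrict_clause C (\<phi> w)) (Disj (xor_vec Is w)))"

definition interpolant :: "nat \<Rightarrow> (bool list \<Rightarrow> 'a cnf) \<Rightarrow> 'a form list \<Rightarrow> bool" where
  "interpolant n \<phi> Is \<longleftrightarrow> partial_interpolant n \<phi> {} Is"


section \<open>Resolution proofs\<close>

text \<open>
  In \<open>Res a u u'\<close> the literal \<open>a\<close> is the pivot, \<open>u\<close> the premise containing \<open>a\<close> and \<open>u'\<close> the
  premise containing its complement.
\<close>

datatype ('a, 'v) inference = Hyp | Axi | Res "'a literal" 'v 'v

record ('a, 'v) res_proof =
  nodes :: "'v set"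
  root :: 'v
  label :: "'v \<Rightarrow> 'a clause"
  rule_of :: "'v \<Rightarrow> ('a, 'v) inference"

definition premise_rel :: "('a, 'v) res_proof \<Rightarrow> ('v \<times> 'v) set" where
  "premise_rel P =
     {(u, v). v \<in> nodes P \<and> (\<exists>a u'. rule_of P v = Res a u u' \<or> rule_of P v = Res a u' u)}"

definition resolvent :: "'a literal \<Rightarrow> 'a clause \<Rightarrow> 'a clause \<Rightarrow> 'a clause \<Rightarrow> bool" where
  "resolvent a E E' R \<longleftrightarrow> (\<exists>C D. E = insert a C \<and> E' = insert (compl a) D \<and> R = C \<union> D)"

definition node_ok :: "'a cnf \<Rightarrow> ('a, 'v) res_proof \<Rightarrow> 'v \<Rightarrow> bool" where
  "node_ok \<Phi> P v \<longleftrightarrow> (case rule_of P v of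
       Hyp \<Rightarrow> label P v \<in> \<Phi>
     | Axi \<Rightarrow> is_clause (label P v) \<and> theory_tautology (label P v)
     | Res a u u' \<Rightarrow> u \<in> nodes P \<and> u' \<in> nodes P \<and>
         resolvent a (label P u) (label P u') (label P v))"

definition unsat_proof :: "'a cnf \<Rightarrow> ('a, 'v) res_proof \<Rightarrow> bool" where
  "unsat_proof \<Phi> P \<longleftrightarrow>
     finite (nodes P) \<and> acyclic (premise_rel P) \<and>
     root P \<in> nodes P \<and> (\<forall>v\<in>nodes P. (v, root P) \<in> (premise_rel P)\<^sup>*) \<and>
     (\<forall>v\<in>nodes P. node_ok \<Phi> P v) \<and>
     label P (root P) = {}"

definition leaves :: "('a, 'v) res_proof \<Rightarrow> 'v set" where
  "leaves P = {v \<in> nodes P. rule_of P v = Hyp \<or> rule_of P v = Axi}"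

definition colorable :: "nat \<Rightarrow> (bool list \<Rightarrow> 'a cnf) \<Rightarrow> ('a, 'v) res_proof \<Rightarrow> bool" where
  "colorable n \<phi> P \<longleftrightarrow>
     (\<forall>v\<in>leaves P. \<exists>w\<in>words n. symb_clause (label P v) \<subseteq> symb_cnf (\<phi> w))"

text \<open>
  A node is derived from a partition if each leaf above it is a hypothesis taken from that partition
  or a theory tautology over the symbols of that partition.
\<close>

definition derived_from :: "'a cnf \<Rightarrow> ('a, 'v) res_proof \<Rightarrow> 'v \<Rightarrow> bool" where
  "derived_from \<Psi> P v \<longleftrightarrow> (\<forall>u\<in>leaves P. (u, v) \<in> (premise_rel P)\<^sup>* \<longrightarrow>
     (rule_of P u = Hyp \<longrightarrow> label P u \<in> \<Psi>) \<and>
     (rule_of P u = Axi \<longrightarrow> symb_clause (label P u) \<subseteq> symb_cnf \<Psi>))"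

definition local_first :: "nat \<Rightarrow> (bool list \<Rightarrow> 'a cnf) \<Rightarrow> ('a, 'v) res_proof \<Rightarrow> bool" where
  "local_first n \<phi> P \<longleftrightarrow>
     (\<forall>v\<in>nodes P. \<forall>a u u'. rule_of P v = Res a u u' \<longrightarrow>
        \<not> symb_lit a \<subseteq> global_symbols n \<phi> \<longrightarrow>
        (\<exists>w\<in>words n. derived_from (\<phi> w) P u \<and> derived_from (\<phi> w) P u'))"


section \<open>Annotation\<close>

definition res_entry :: "'a literal \<Rightarrow> 'a form \<Rightarrow> 'a form \<Rightarrow> 'a form" where
  "res_entry a I J = And (Or (lit_form a) I) (Or (lit_form (compl a)) J)"

text \<open>
  Annotation is a relation, as the rules do not determine the annotation of a node: a clause may
  belong to several partitions, a tautology may be expressible in several partitions, and both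
  resolution rules may apply. A node shared in the DAG can need different annotations for its
  different uses.
\<close>

inductive annotated ::
  "nat \<Rightarrow> (bool list \<Rightarrow> 'a cnf) \<Rightarrow> ('a, 'v) res_proof \<Rightarrow> 'v \<Rightarrow> 'a form list \<Rightarrow> bool"
  for n \<phi> P where
  mHyp: "\<lbrakk>v \<in> nodes P; rule_of P v = Hyp; w \<in> words n; label P v \<in> \<phi> w\<rbrakk>
    \<Longrightarrow> annotated n \<phi> P v (const_vec w)"
| mAxi: "\<lbrakk>v \<in> nodes P; rule_of P v = Axi; w \<in> words n;
      symb_clause (label P v) \<subseteq> symb_cnf (\<phi> w)\<rbrakk>
    \<Longrightarrow> annotated n \<phi> P v (const_vec w)"
| mRes: "\<lbrakk>v \<in> nodes P; rule_of P v = Res a u u';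
      label P u = insert a C; label P u' = insert (compl a) D; label P v = C \<union> D;
      w \<in> words n; annotated n \<phi> P u (const_vec w); annotated n \<phi> P u' (const_vec w);
      symb_clause (insert a (C \<union> D)) \<subseteq> symb_cnf (\<phi> w)\<rbrakk>
    \<Longrightarrow> annotated n \<phi> P v (const_vec w)"
| mResG: "\<lbrakk>v \<in> nodes P; rule_of P v = Res a u u';
      label P u = insert a C; label P u' = insert (compl a) D; label P v = C \<union> D;
      symb_lit a \<subseteq> global_symbols n \<phi>;
      annotated n \<phi> P u IC; annotated n \<phi> P u' ID\<rbrakk>
    \<Longrightarrow> annotated n \<phi> P v (map2 (res_entry a) IC ID)"

end

theory Submission
  imports Defs
begin

text \<open>
  Soundness is by induction on the annotation. A constant vector \<open>w\<close> makes \<open>\<Or>(w \<oplus> w')\<close> true for all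
  \<open>w' \<noteq> w\<close>, so only the partition \<open>\<phi>\<^sub>w\<close> itself has to imply the clause. At a global pivot, the new
  vector is equivalent to the annotation of whichever premise has its pivot literal false.
  Every node has an annotation: a node derived from \<open>\<phi>\<^sub>w\<close> is annotated with \<open>w\<close>, and
  local-firstness makes this available at both premises of each local pivot.
\<close>

section \<open>Truth values and symbols of annotation vectors\<close>

lemma sat_compl [simp]: "sat M (lit_form (compl a)) \<longleftrightarrow> \<not> sat M (lit_form a)"
  by (cases a) auto

lemma symb_lit_compl [simp]: "symb_lit (compl a) = symb_lit a"
  by (cases a) (auto simp: symb_lit_def)

lemma sat_Disj: "sat M (Disj Is) \<longleftrightarrow> (\<exists>I\<in>set Is. sat M I)"
  unfolding Disj_def by (induction Is) auto

text \<open>Exclusive-or with a truth constant expresses disagreement with it, so the disjunction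
  says that the truth values of the entries do not spell the word \<open>w\<close>.\<close>

lemma sat_Disj_xor_vec:
  assumes "length Is = length w"
  shows "sat M (Disj (xor_vec Is w)) \<longleftrightarrow> (\<exists>i<length w. sat M (Is ! i) \<noteq> w ! i)"
  using assms
  by (auto simp: sat_Disj xor_vec_def set_zip xor_const_def)

lemma sat_Disj_xor_const_vec:
  assumes "length w = length w'"
  shows "sat M (Disj (xor_vec (const_vec w) w')) \<longleftrightarrow> w \<noteq> w'"
  using assms by (auto simp: sat_Disj_xor_vec const_vec_def list_eq_iff_nth_eq)

text \<open>The formula built by the rule \<open>mResG\<close> is an if-then-else on the
  pivot.\<close>

lemma sat_res_entry:
  "sat M (res_entry a I J) \<longleftrightarrow> (if sat M (lit_form a) then sat M J else sat M I)"
  by (auto simp: res_entry_def And_def)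

lemma symb_res_entry: "symb (res_entry a I J) = symb_lit a \<union> symb I \<union> symb J"
  using symb_lit_compl[of a] by (auto simp: res_entry_def And_def symb_lit_def)

section \<open>Soundness of the annotation rules\<close>

text \<open>At the word \<open>w\<close> itself the disjunction is false, at every other word it is
  true, and constants contain no symbols. This reduces the three rules with a constant vector to
  implications between clauses.\<close>

lemma partial_interpolant_const_vec:
  assumes "w \<in> words n"
  shows "partial_interpolant n \<phi> C (const_vec w) \<longleftrightarrow>
    valid_imp (conj_parts n \<phi>) C (Const False) \<and>
    valid_imp (\<phi> w) (restrict_clause C (\<phi> w)) (Const False)"
proof -
  have "valid_imp (\<phi> w') (restrict_clause C (\<phi> w')) (Disj (xor_vec (const_vec w) w')) \<longleftrightarrow>
      w' \<noteq> w \<or> valid_imp (\<phi> w) (restrict_clause C (\<phi> w)) (Const False)"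
    if "w' \<in> words n" for w'
    using assms that by (auto simp: valid_imp_def words_def sat_Disj_xor_const_vec)
  moreover have "length (const_vec w) = n" "\<forall>I\<in>set (const_vec w). symb I \<subseteq> global_symbols n \<phi>"
    using assms by (auto simp: const_vec_def words_def)
  ultimately show ?thesis
    using assms unfolding partial_interpolant_def by blast
qed

lemma valid_imp_resolvent:
  assumes "valid_imp \<Phi> (insert a C) (Const False)"
    and "valid_imp \<Phi> (insert (compl a) D) (Const False)"
  shows "valid_imp \<Phi> (C \<union> D) (Const False)"
  unfolding valid_imp_def
proof (intro allI impI)
  fix M :: "('a, nat) struc"
  assume "is_struc M" "sat_cnf M \<Phi>"
  then have "sat_clause M (insert a C)" "sat_clause M (insert (compl a) D)"
    using assms by (simp_all add: valid_imp_def)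
  then show "sat_clause M (C \<union> D) \<or> sat M (Const False)"
    by (auto simp: sat_clause_def)
qed

text \<open>In the premise whose pivot literal is false in \<open>M\<close>, a true literal must lie
  in the rest of the clause, and so it survives into the restricted resolvent. \<open>X\<close> and
  \<open>Y\<close> stand for the disjunctions over the annotations, so that both resolution rules
  are covered.\<close>

lemma restrict_clause_resolvent:
  assumes "sat_clause M (restrict_clause (insert a C) \<Psi>) \<or> X"
    and "sat_clause M (restrict_clause (insert (compl a) D) \<Psi>) \<or> Y"
  shows "sat_clause M (restrict_clause (C \<union> D) \<Psi>) \<or> (if sat M (lit_form a) then Y else X)"
  using assms by (auto simp: sat_clause_def restrict_clause_def)

lemma partial_interpolant_res_const:
  assumes "w \<in> words n"
    and "partial_interpolant n \<phi> (insert a C) (const_vec w)"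
    and "partial_interpolant n \<phi> (insert (compl a) D) (const_vec w)"
  shows "partial_interpolant n \<phi> (C \<union> D) (const_vec w)"
proof -
  have "valid_imp (\<phi> w) (restrict_clause (C \<union> D) (\<phi> w)) (Const False)"
    unfolding valid_imp_def
  proof (intro allI impI)
    fix M :: "('a, nat) struc"
    assume "is_struc M" "sat_cnf M (\<phi> w)"
    then show "sat_clause M (restrict_clause (C \<union> D) (\<phi> w)) \<or> sat M (Const False)"
      \<comment> \<open>Both disjunctions are false here, since the vector is \<open>w\<close>
        itself.\<close>
      using assms restrict_clause_resolvent[of M a C "\<phi> w" False D False]
      by (simp add: partial_interpolant_const_vec valid_imp_def)
  qed
  moreover have "valid_imp (conj_parts n \<phi>) (C \<union> D) (Const False)"
    using assms valid_imp_resolvent by (metis partial_interpolant_def)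
  ultimately show ?thesis
    using assms(1) by (simp add: partial_interpolant_const_vec)
qed

lemma partial_interpolant_res_global:
  assumes a: "symb_lit a \<subseteq> global_symbols n \<phi>"
    and C: "partial_interpolant n \<phi> (insert a C) IC"
    and D: "partial_interpolant n \<phi> (insert (compl a) D) ID"
  shows "partial_interpolant n \<phi> (C \<union> D) (map2 (res_entry a) IC ID)"
proof -
  have len: "length IC = n" "length ID = n"
    using C D by (auto simp: partial_interpolant_def)
  have "valid_imp (\<phi> w) (restrict_clause (C \<union> D) (\<phi> w))
      (Disj (xor_vec (map2 (res_entry a) IC ID) w))" if w: "w \<in> words n" for w
    unfolding valid_imp_def
  proof (intro allI impI)
    fix M :: "('a, nat) struc"
    assume M: "is_struc M" "sat_cnf M (\<phi> w)"
    \<comment> \<open>The truth value of the pivot selects the same premise at every position, so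
      the whole disjunction switches between the two annotations.\<close>
    have "sat M (Disj (xor_vec (map2 (res_entry a) IC ID) w)) \<longleftrightarrow>
        (if sat M (lit_form a) then sat M (Disj (xor_vec ID w)) else sat M (Disj (xor_vec IC w)))"
      using w len by (auto simp: words_def sat_Disj_xor_vec sat_res_entry)
    moreover have "sat_clause M (restrict_clause (insert a C) (\<phi> w)) \<or> sat M (Disj (xor_vec IC w))"
      "sat_clause M (restrict_clause (insert (compl a) D) (\<phi> w)) \<or> sat M (Disj (xor_vec ID w))"
      using C D M w by (auto simp: partial_interpolant_def valid_imp_def)
    ultimately show "sat_clause M (restrict_clause (C \<union> D) (\<phi> w)) \<or>
        sat M (Disj (xor_vec (map2 (res_entry a) IC ID) w))"
      using restrict_clause_resolvent by metis
  qed
  moreover have "symb I \<subseteq> global_symbols n \<phi>" if "I \<in> set (map2 (res_entry a) IC ID)" for I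
  proof -
    from that obtain J K where "J \<in> set IC" "K \<in> set ID" "I = res_entry a J K"
      by (auto dest: set_zip_leftD set_zip_rightD)
    then show ?thesis
      using a C D unfolding partial_interpolant_def by (simp add: symb_res_entry)
  qed
  moreover have "valid_imp (conj_parts n \<phi>) (C \<union> D) (Const False)"
    using C D valid_imp_resolvent by (metis partial_interpolant_def)
  ultimately show ?thesis
    using len by (simp add: partial_interpolant_def)
qed

lemma restrict_clause_ident: "symb_clause C \<subseteq> symb_cnf \<Psi> \<Longrightarrow> restrict_clause C \<Psi> = C"
  by (auto simp: restrict_clause_def symb_clause_def)

lemma symb_clause_subset_symb_cnf: "C \<in> \<Psi> \<Longrightarrow> symb_clause C \<subseteq> symb_cnf \<Psi>"
  by (auto simp: symb_cnf_def)

lemma annotated_partial_interpolant: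
  assumes P: "unsat_proof (conj_parts n \<phi>) P"
    and "annotated n \<phi> P v Is"
  shows "partial_interpolant n \<phi> (label P v) Is"
  using assms(2)
proof induction
  case (mHyp v w)
  \<comment> \<open>The clause is a member of \<open>\<phi> w\<close>, hence the restriction keeps
    all of it.\<close>
  then show ?case
    by (auto simp: partial_interpolant_const_vec valid_imp_def sat_cnf_def conj_parts_def
        restrict_clause_ident symb_clause_subset_symb_cnf)
next
  case (mAxi v w)
  \<comment> \<open>The rule \<open>mAxi\<close> speaks of symbols only; validity of the leaf clause
    comes from the proof \<open>P\<close>.\<close>
  then have "theory_tautology (label P v)"
    using P by (auto simp: unsat_proof_def node_ok_def)
  then show ?case
    using mAxi
    by (auto simp: partial_interpolant_const_vec valid_imp_def theory_tautology_def
        restrict_clause_ident)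
next
  case mRes
  then show ?case by (metis partial_interpolant_res_const)
next
  case mResG
  then show ?case by (metis partial_interpolant_res_global)
qed

section \<open>Existence of annotations\<close>

text \<open>Premises of nodes are nodes, so the relation is finite as well as acyclic. This permits
  induction from the leaves to the root.\<close>

lemma wf_premise_rel:
  assumes "unsat_proof \<Phi> P"
  shows "wf (premise_rel P)"
proof (rule finite_acyclic_wf)
  have "premise_rel P \<subseteq> nodes P \<times> nodes P"
  proof clarify
    fix u v
    assume "(u, v) \<in> premise_rel P"
    then obtain a u' where "v \<in> nodes P" "rule_of P v = Res a u u' \<or> rule_of P v = Res a u' u"
      unfolding premise_rel_def by blast
    moreover from this have "node_ok \<Phi> P v"
      using assms by (simp add: unsat_proof_def)
    ultimately show "u \<in> nodes P \<and> v \<in> nodes P"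
      by (auto simp: node_ok_def)
  qed
  then show "finite (premise_rel P)"
    using assms by (meson finite_SigmaI finite_subset unsat_proof_def)
qed (use assms in \<open>simp add: unsat_proof_def\<close>)

lemma derived_from_premise:
  assumes "derived_from \<Psi> P v" "(u, v) \<in> premise_rel P"
  shows "derived_from \<Psi> P u"
  using assms by (meson derived_from_def rtrancl.rtrancl_into_rtrancl)

lemma proof_node_cases:
  assumes "unsat_proof \<Phi> P" "v \<in> nodes P"
  obtains
    (Hyp) "rule_of P v = Hyp" "label P v \<in> \<Phi>" "v \<in> leaves P"
  | (Axi) "rule_of P v = Axi" "v \<in> leaves P"
  | (Res) a u u' C D where "rule_of P v = Res a u u'" "u \<in> nodes P" "u' \<in> nodes P"
      "(u, v) \<in> premise_rel P" "(u', v) \<in> premise_rel P"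
      "label P u = insert a C" "label P u' = insert (compl a) D" "label P v = C \<union> D"
proof (cases "rule_of P v")
  case (Res a u u')
  have ok: "node_ok \<Phi> P v"
    using assms by (simp add: unsat_proof_def)
  then obtain C D where "label P u = insert a C" "label P u' = insert (compl a) D"
      "label P v = C \<union> D"
    using Res by (auto simp: node_ok_def resolvent_def)
  moreover have "u \<in> nodes P" "u' \<in> nodes P" "(u, v) \<in> premise_rel P" "(u', v) \<in> premise_rel P"
    using ok Res assms(2) by (auto simp: node_ok_def premise_rel_def)
  ultimately show ?thesis
    using Res that(3) by blast
qed (use assms that in \<open>auto simp: unsat_proof_def node_ok_def leaves_def\<close>)

text \<open>The symbol bound is proved together with the annotation because \<open>mRes\<close>
  requires the pivot and the resolvent to be over the symbols of \<open>\<phi> w\<close>; the labels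
  of the premises supply this bound.\<close>

lemma derived_from_annotated:
  assumes P: "unsat_proof \<Phi> P" and w: "w \<in> words n"
    and "v \<in> nodes P" "derived_from (\<phi> w) P v"
  shows "symb_clause (label P v) \<subseteq> symb_cnf (\<phi> w) \<and> annotated n \<phi> P v (const_vec w)"
  using wf_premise_rel[OF P] assms(3,4)
proof (induction v rule: wf_induct_rule)
  case (less v)
  from P less.prems(1) show ?case
  proof (cases rule: proof_node_cases)
    case Hyp
    then have "label P v \<in> \<phi> w"
      using less.prems by (auto simp: derived_from_def)
    then show ?thesis
      using Hyp less.prems w by (auto intro: annotated.mHyp dest: symb_clause_subset_symb_cnf)
  next
    case Axi
    then have "symb_clause (label P v) \<subseteq> symb_cnf (\<phi> w)"
      using less.prems by (auto simp: derived_from_def)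
    then show ?thesis
      using Axi less.prems w by (auto intro: annotated.mAxi)
  next
    case (Res a u u' C D)
    have u: "symb_clause (label P u) \<subseteq> symb_cnf (\<phi> w)" "annotated n \<phi> P u (const_vec w)"
      and u': "symb_clause (label P u') \<subseteq> symb_cnf (\<phi> w)" "annotated n \<phi> P u' (const_vec w)"
      using less.IH[OF Res(4) Res(2)] less.IH[OF Res(5) Res(3)]
        derived_from_premise[OF less.prems(2)] Res(4,5) by auto
    then have "symb_clause (insert a (C \<union> D)) \<subseteq> symb_cnf (\<phi> w)"
      using Res(6,7) by (auto simp: symb_clause_def)
    moreover from this have "symb_clause (label P v) \<subseteq> symb_cnf (\<phi> w)"
      using Res(8) by (auto simp: symb_clause_def)
    ultimately show ?thesis
      using annotated.mRes[OF less.prems(1) Res(1,6-8) w u(2) u'(2)] by blast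
  qed
qed

lemma annotated_exists:
  assumes P: "unsat_proof (conj_parts n \<phi>) P"
    and col: "colorable n \<phi> P" and loc: "local_first n \<phi> P"
    and "v \<in> nodes P"
  shows "\<exists>Is. annotated n \<phi> P v Is"
  using wf_premise_rel[OF P] assms(4)
proof (induction v rule: wf_induct_rule)
  case (less v)
  from P less.prems show ?case
  proof (cases rule: proof_node_cases)
    case Hyp
    then show ?thesis
      using less.prems by (auto simp: conj_parts_def intro: annotated.mHyp)
  next
    case Axi
    then obtain w where "w \<in> words n" "symb_clause (label P v) \<subseteq> symb_cnf (\<phi> w)"
      using col unfolding colorable_def by blast
    then show ?thesis
      using annotated.mAxi[OF less.prems Axi(1)] by blast
  next
    case (Res a u u' C D)
    show ?thesis
    proof (cases "symb_lit a \<subseteq> global_symbols n \<phi>")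
      case True
      then show ?thesis
        using annotated.mResG[OF less.prems Res(1,6-8)] less.IH Res(2-5) by metis
    next
      case False
      \<comment> \<open>Annotations from the induction hypothesis could differ between the premises,
        whereas \<open>mRes\<close> needs one common constant vector. Local-firstness provides its
        word.\<close>
      then obtain w where w: "w \<in> words n" "derived_from (\<phi> w) P u" "derived_from (\<phi> w) P u'"
        using loc less.prems Res(1) unfolding local_first_def by blast
      note u = derived_from_annotated[where \<phi> = \<phi>, OF P w(1) Res(2) w(2)]
      note u' = derived_from_annotated[where \<phi> = \<phi>, OF P w(1) Res(3) w(3)]
      have "symb_clause (insert a (C \<union> D)) \<subseteq> symb_cnf (\<phi> w)"
        using u u' Res(6,7) by (auto simp: symb_clause_def)
      then show ?thesis
        using annotated.mRes[OF less.prems Res(1,6-8) w(1)] u u' by blast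
    qed
  qed
qed

text \<open>Soundness alone would be vacuous at a node without annotation, so existence is stated
  along with it.\<close>

theorem theorem3:
  fixes n :: nat and \<phi> :: "bool list \<Rightarrow> 'a cnf" and P :: "('a, 'v) res_proof"
  assumes "\<forall>w\<in>words n. is_cnf (\<phi> w)"
    and "unsatisfiable (conj_parts n \<phi>)"
    and "unsat_proof (conj_parts n \<phi>) P"
    and "colorable n \<phi> P"
    and "local_first n \<phi> P"
  shows "(\<forall>v\<in>nodes P. (\<exists>Is. annotated n \<phi> P v Is) \<and>
           (\<forall>Is. annotated n \<phi> P v Is \<longrightarrow> partial_interpolant n \<phi> (label P v) Is)) \<and>
         (\<forall>Is. annotated n \<phi> P (root P) Is \<longrightarrow> interpolant n \<phi> Is)"
proof -
  have "label P (root P) = {}"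
    using assms(3) by (simp add: unsat_proof_def)
  then show ?thesis
    using annotated_exists[OF assms(3-5)] annotated_partial_interpolant[OF assms(3)]
    by (metis interpolant_def)
qed

end
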